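(* For every $n\ge 0$ and $m\ge 1$, the product $S^n\times (S^1)^m$ of the $n$-dimensional sphere and the $m$-dimensional torus carries an $h$-tileable triangulation; that is, there exists a finite simplicial complex $K$ with $|K|$ homeomorphic to $S^n\times (S^1)^m$ such that $|K|$ admits an $h$-tiling.
   Context: A facet of a simplex is a codimension one face (the empty set is regarded as the unique facet of a $0$-simplex). A basic tile of dimension $n$ and order $k\in\{0,\dots,n+1\}$ is a (closed) $n$-simplex deprived of $k$ of its facets. Let $K$ be a finite simplicial complex with underlying topological space $|K|$. An $h$-tiling of a subset $S\subset |K|$ is a partition of $S$ by basic tiles, each of which is obtained from a simplex of $K$, such that for every $j\ge 0$ the union of the tiles of dimension $\ge j$ is closed in $S$; $K$ is $h$-tileable if $S=|K|$ admits an $h$-tiling. A triangulation of a manifold is a homeomorphism between it and $|K|$ for some simplicial complex $K$. *)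

theory Defs
  imports "HOL-Analysis.Analysis" "HOL-Library.Disjoint_Sets"
begin

text \<open>Finite abstract simplicial complexes, a simplex being identified with its nonempty finite set of
  vertices. The abstract version is used because the dimension of the Euclidean space in which a
  geometric complex lives would have to be quantified existentially.\<close>

definition finite_complex :: "'v set set \<Rightarrow> bool" where
  "finite_complex K \<longleftrightarrow>
     finite K \<and>
     (\<forall>\<sigma>\<in>K. finite \<sigma> \<and> \<sigma> \<noteq> {}) \<and>
     (\<forall>\<sigma>\<in>K. \<forall>\<tau>. \<tau> \<subseteq> \<sigma> \<and> \<tau> \<noteq> {} \<longrightarrow> \<tau> \<in> K)"

text \<open>The closed simplex spanned by \<open>\<sigma>\<close>, in barycentric coordinates indexed by the vertices. Note
  \<open>closed_simplex {} = {}\<close>.\<close>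

definition closed_simplex :: "'v set \<Rightarrow> ('v \<Rightarrow> real) set" where
  "closed_simplex \<sigma> = {x. (\<forall>v. 0 \<le> x v) \<and> (\<forall>v. v \<notin> \<sigma> \<longrightarrow> x v = 0) \<and> (\<Sum>v\<in>\<sigma>. x v) = 1}"

definition polyhedron_of :: "'v set set \<Rightarrow> ('v \<Rightarrow> real) set" where
  "polyhedron_of K = (\<Union>\<sigma>\<in>K. closed_simplex \<sigma>)"

text \<open>All points of \<open>polyhedron_of K\<close> are supported in the finite vertex set of a finite complex \<open>K\<close>,
  so the product topology induces on it the usual (Euclidean) topology.\<close>

definition realization :: "'v set set \<Rightarrow> ('v \<Rightarrow> real) topology" where
  "realization K = subtopology (product_topology (\<lambda>_. euclideanreal) UNIV) (polyhedron_of K)"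

text \<open>Codimension one faces; the unique facet of a 0-simplex is the empty set.\<close>

definition facets :: "'v set \<Rightarrow> 'v set set" where
  "facets \<sigma> = {\<tau>. \<tau> \<subseteq> \<sigma> \<and> card \<tau> + 1 = card \<sigma>}"

text \<open>\<open>T\<close> is a basic tile of dimension \<open>d\<close> and order \<open>k\<close> obtained from a simplex of \<open>K\<close>. The bound
  \<open>k \<le> d + 1\<close> holds automatically, as a \<open>d\<close>-simplex has \<open>d + 1\<close> facets.\<close>

definition basic_tile :: "'v set set \<Rightarrow> nat \<Rightarrow> nat \<Rightarrow> ('v \<Rightarrow> real) set \<Rightarrow> bool" where
  "basic_tile K d k T \<longleftrightarrow>
     (\<exists>\<sigma>\<in>K. card \<sigma> = d + 1 \<and>
        (\<exists>\<Phi>\<subseteq>facets \<sigma>. card \<Phi> = k \<and> T = closed_simplex \<sigma> - (\<Union>\<tau>\<in>\<Phi>. closed_simplex \<tau>)))"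

text \<open>A basic tile contains the interior of its simplex, hence determines this simplex and its own
  dimension, so a tiling may be given as a bare set of subsets of \<open>S\<close>.\<close>

definition h_tiling :: "'v set set \<Rightarrow> ('v \<Rightarrow> real) set \<Rightarrow> ('v \<Rightarrow> real) set set \<Rightarrow> bool" where
  "h_tiling K S P \<longleftrightarrow>
     partition_on S P \<and>
     (\<forall>T\<in>P. \<exists>d k. basic_tile K d k T) \<and>
     (\<forall>j. closedin (subtopology (realization K) S)
            (\<Union>{T \<in> P. \<exists>d k. j \<le> d \<and> basic_tile K d k T}))"

definition h_tileable :: "'v set set \<Rightarrow> bool" where
  "h_tileable K \<longleftrightarrow> (\<exists>P. h_tiling K (polyhedron_of K) P)"

end

theory Submission
  imports Defs
begin

text \<open>If all tiles of a partition of the polyhedron have the same dimension \<open>d\<close>, the closedness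
  condition is automatic. A \<open>d\<close>-simplex \<open>\<sigma>\<close> deprived of the facets opposite to the
  vertices in \<open>R \<subseteq> \<sigma>\<close> is the union of the open faces \<open>\<tau>\<close> with \<open>R \<subseteq> \<tau> \<subseteq> \<sigma>\<close>. Hence tileability
  follows from a partition of the set of faces into intervals \<open>[R, \<sigma>]\<close> with \<open>\<sigma>\<close> of dimension \<open>d\<close>
  (\<open>face_tiling\<close>, \<open>h_tileable_if_face_tiling\<close>), where \<open>R\<close> may well be empty more than once. This
  is much weaker than the existence of a shelling and survives multiplication by a circle.

  For the sphere the boundary of the cross-polytope serves: a face is determined by its positive and
  its negative vertices, and one puts it in the facet that keeps its negative vertices and is
  positive in all other coordinates (\<open>face_tiling_cross_polytope\<close>). Taking signed square roots of the
  coordinates maps the polyhedron to the round sphere (\<open>realization_cross_polytope\<close>).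

  The circle is the case of dimension one, a directed 4-cycle. For a complex \<open>K\<close> with linearly
  ordered vertices, the prism over a simplex of \<open>K\<close> along an edge of the cycle is cut by the usual
  staircase, and these pieces fit together to a triangulation of the product
  (\<open>realization_circle_product\<close>). A tile times a half-open edge is again a disjoint union of tiles:
  the piece of the staircase that steps up at the vertex \<open>v\<close> gets the faces in which \<open>v\<close> is the last
  vertex on the lower level (\<open>face_tiling_circle_product\<close>). All edges are treated alike,
  so half-open edges cover the cycle without overlap. Induction on the number of circles concludes.\<close>

section \<open>Points of a polyhedron and their supports\<close>

lemma finite_complexD:
  assumes "finite_complex K"
  shows "finite K" "\<sigma> \<in> K \<Longrightarrow> finite \<sigma>" "\<sigma> \<in> K \<Longrightarrow> \<sigma> \<noteq> {}"
    "\<sigma> \<in> K \<Longrightarrow> \<tau> \<subseteq> \<sigma> \<Longrightarrow> \<tau> \<noteq> {} \<Longrightarrow> \<tau> \<in> K"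
  using assms unfolding finite_complex_def by blast+

lemma finite_complex_vertices: "finite_complex K \<Longrightarrow> finite (\<Union>K)"
  using finite_complexD(1,2) by blast

definition supp :: "('v \<Rightarrow> real) \<Rightarrow> 'v set" where
  "supp x = {v. x v \<noteq> 0}"

lemma in_supp: "v \<in> supp x \<longleftrightarrow> x v \<noteq> 0"
  by (simp add: supp_def)

lemma closed_simplex_iff:
  "x \<in> closed_simplex \<sigma> \<longleftrightarrow> (\<forall>v. 0 \<le> x v) \<and> supp x \<subseteq> \<sigma> \<and> sum x \<sigma> = 1"
  by (auto simp: closed_simplex_def supp_def)

lemma sum_eq_if_supp_subset:
  assumes "finite V" "supp x \<subseteq> V" "finite W" "supp x \<subseteq> W"
  shows "sum x V = sum x W"
proof -
  have "sum x V = sum x (supp x)"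
    using assms by (intro sum.mono_neutral_right) (auto simp: supp_def)
  also have "\<dots> = sum x W"
    using assms by (intro sum.mono_neutral_left) (auto simp: supp_def)
  finally show ?thesis .
qed

text \<open>The support of a point is its carrier, the face whose open simplex contains it. This
  description of the polyhedron reduces statements about points to statements about faces. The
  normalisation is taken over any finite set \<open>V\<close> containing the vertices, so that it does not depend on the point.\<close>
lemma polyhedron_iff:
  assumes K: "finite_complex K" and V: "finite V" "\<Union>K \<subseteq> V"
  shows "x \<in> polyhedron_of K \<longleftrightarrow> (\<forall>v. 0 \<le> x v) \<and> supp x \<in> K \<and> sum x V = 1"
proof
  assume "x \<in> polyhedron_of K"
  then obtain \<sigma> where s: "\<sigma> \<in> K" "x \<in> closed_simplex \<sigma>"
    by (auto simp: polyhedron_of_def)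
  then have x: "\<forall>v. 0 \<le> x v" "supp x \<subseteq> \<sigma>" "sum x \<sigma> = 1"
    by (auto simp: closed_simplex_iff)
  have fin: "finite \<sigma>" and "\<sigma> \<subseteq> V"
    using finite_complexD(2)[OF K] V s by blast+
  moreover have "supp x \<noteq> {}"
  proof
    assume "supp x = {}"
    then have "sum x \<sigma> = 0" by (auto simp: supp_def)
    then show False using x by simp
  qed
  ultimately have "supp x \<in> K" "sum x V = sum x \<sigma>"
    using finite_complexD(4)[OF K s(1) x(2)] sum_eq_if_supp_subset[OF V(1) _ fin x(2)] x(2) by auto
  then show "(\<forall>v. 0 \<le> x v) \<and> supp x \<in> K \<and> sum x V = 1"
    using x by simp
next
  assume x: "(\<forall>v. 0 \<le> x v) \<and> supp x \<in> K \<and> sum x V = 1"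
  then have "finite (supp x)" "supp x \<subseteq> V"
    using finite_complexD(2)[OF K] V by auto
  then have "x \<in> closed_simplex (supp x)"
    using x V(1) sum_eq_if_supp_subset[of V x "supp x"] by (auto simp: closed_simplex_iff)
  then show "x \<in> polyhedron_of K"
    using x by (auto simp: polyhedron_of_def)
qed

lemma realization_eq: "realization K = top_of_set (polyhedron_of K)"
  by (simp add: realization_def euclidean_product_topology)

lemma compact_closed_simplex:
  assumes "finite \<sigma>"
  shows "compact (closed_simplex \<sigma>)"
proof -
  have "compactin (product_topology (\<lambda>_::'a. euclideanreal) UNIV) (PiE UNIV (\<lambda>_. {0..1}))"
    by (simp add: compactin_PiE)
  then have box: "compact (PiE UNIV (\<lambda>_::'a. {0..1::real}))"
    by (simp add: euclidean_product_topology)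
  \<comment> \<open>a closed subset of the compact cube\<close>
  have "closed_simplex \<sigma> =
      (\<Inter>v. {x. 0 \<le> x v}) \<inter> (\<Inter>v\<in>-\<sigma>. {x. x v = 0}) \<inter> {x. (\<Sum>v\<in>\<sigma>. x v) = 1}"
    by (auto simp: closed_simplex_def)
  moreover have "closed \<dots>"
    by (intro closed_Int closed_INT ballI closed_Collect_le closed_Collect_eq continuous_intros
        continuous_on_product_coordinates)
  moreover have "closed_simplex \<sigma> \<subseteq> PiE UNIV (\<lambda>_. {0..1})"
  proof
    fix x assume "x \<in> closed_simplex \<sigma>"
    then have x: "\<forall>v. 0 \<le> x v" "supp x \<subseteq> \<sigma>" "sum x \<sigma> = 1"
      by (auto simp: closed_simplex_iff)
    have "x v \<le> 1" for v
    proof (cases "v \<in> \<sigma>")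
      case True
      then have "x v \<le> sum x \<sigma>" using assms x by (intro member_le_sum) auto
      then show ?thesis using x by simp
    next
      case False
      then have "x v = 0" using x by (auto simp: supp_def)
      then show ?thesis by simp
    qed
    then show "x \<in> PiE UNIV (\<lambda>_. {0..1})" using x by auto
  qed
  ultimately show ?thesis
    using box by (metis compact_Int_closed inf.absorb_iff2)
qed

text \<open>Compactness and the Hausdorff property make every continuous bijection between polyhedra a
  homeomorphism, also onto a product, which spares the proof of continuity of the inverse of the staircase coordinates.\<close>
lemma compact_space_realization:
  assumes "finite_complex K"
  shows "compact_space (realization K)"
proof -
  have "compact (polyhedron_of K)"
    unfolding polyhedron_of_def using assms
    by (intro compact_UN compact_closed_simplex) (auto dest: finite_complexD(1,2))
  then show ?thesis
    by (simp add: realization_eq compact_space_subtopology)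
qed

lemma Hausdorff_space_realization: "Hausdorff_space (realization K)"
  unfolding realization_def
  by (intro Hausdorff_space_subtopology) (simp add: Hausdorff_space_product_topology)

section \<open>Tilings as partitions of the face poset\<close>

text \<open>A pair \<open>(R, \<sigma>)\<close> stands for the simplex \<open>\<sigma>\<close> without the facets opposite to the vertices in \<open>R\<close>;
  it covers the open faces in the interval from \<open>R\<close> to \<open>\<sigma>\<close>.\<close>
definition face_tiling :: "'v set set \<Rightarrow> nat \<Rightarrow> ('v set \<times> 'v set) set \<Rightarrow> bool" where
  "face_tiling K d I \<longleftrightarrow>
     (\<forall>(R, \<sigma>)\<in>I. R \<subseteq> \<sigma> \<and> \<sigma> \<in> K \<and> card \<sigma> = d + 1) \<and>
     (\<forall>\<tau>\<in>K. \<exists>!p. p \<in> I \<and> fst p \<subseteq> \<tau> \<and> \<tau> \<subseteq> snd p)"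

lemma face_tilingI:
  assumes intervals: "\<And>R \<sigma>. (R, \<sigma>) \<in> I \<Longrightarrow> R \<subseteq> \<sigma> \<and> \<sigma> \<in> K \<and> card \<sigma> = d + 1"
    and ex1: "\<And>\<tau>. \<tau> \<in> K \<Longrightarrow> \<exists>R \<sigma>. (R, \<sigma>) \<in> I \<and> R \<subseteq> \<tau> \<and> \<tau> \<subseteq> \<sigma> \<and>
      (\<forall>R' \<sigma>'. (R', \<sigma>') \<in> I \<longrightarrow> R' \<subseteq> \<tau> \<longrightarrow> \<tau> \<subseteq> \<sigma>' \<longrightarrow> R' = R \<and> \<sigma>' = \<sigma>)"
  shows "face_tiling K d I"
  unfolding face_tiling_def
proof (intro conjI ballI)
  fix p assume "p \<in> I"
  then show "case p of (R, \<sigma>) \<Rightarrow> R \<subseteq> \<sigma> \<and> \<sigma> \<in> K \<and> card \<sigma> = d + 1"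
    using intervals[of "fst p" "snd p"] by (cases p) simp
next
  fix \<tau> assume "\<tau> \<in> K"
  from ex1[OF this] obtain R \<sigma> where p: "(R, \<sigma>) \<in> I \<and> R \<subseteq> \<tau> \<and> \<tau> \<subseteq> \<sigma> \<and>
      (\<forall>R' \<sigma>'. (R', \<sigma>') \<in> I \<longrightarrow> R' \<subseteq> \<tau> \<longrightarrow> \<tau> \<subseteq> \<sigma>' \<longrightarrow> R' = R \<and> \<sigma>' = \<sigma>)"
    by (elim exE) (rule that)
  note uniq = p[THEN conjunct2, THEN conjunct2, THEN conjunct2, rule_format]
  show "\<exists>!p. p \<in> I \<and> fst p \<subseteq> \<tau> \<and> \<tau> \<subseteq> snd p"
  proof (rule ex1I[of _ "(R, \<sigma>)"])
    fix q assume q: "q \<in> I \<and> fst q \<subseteq> \<tau> \<and> \<tau> \<subseteq> snd q"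
    then have "(fst q, snd q) \<in> I" unfolding prod.collapse by (rule conjunct1)
    then have "fst q = R \<and> snd q = \<sigma>"
      using q[THEN conjunct2, THEN conjunct1] q[THEN conjunct2, THEN conjunct2] by (rule uniq)
    then show "q = (R, \<sigma>)" by (simp add: prod_eq_iff)
  next
    show "(R, \<sigma>) \<in> I \<and> fst (R, \<sigma>) \<subseteq> \<tau> \<and> \<tau> \<subseteq> snd (R, \<sigma>)"
      unfolding fst_conv snd_conv
      by (intro conjI p[THEN conjunct1] p[THEN conjunct2, THEN conjunct1]
          p[THEN conjunct2, THEN conjunct2, THEN conjunct1])
  qed
qed

lemma face_tilingD:
  assumes "face_tiling K d I" "(R, \<sigma>) \<in> I"
  shows "R \<subseteq> \<sigma>" "\<sigma> \<in> K" "card \<sigma> = d + 1"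
  using assms by (auto simp: face_tiling_def)

lemma face_tiling_ex:
  assumes "face_tiling K d I" "\<tau> \<in> K"
  obtains R \<sigma> where "(R, \<sigma>) \<in> I" "R \<subseteq> \<tau>" "\<tau> \<subseteq> \<sigma>"
  using assms unfolding face_tiling_def by (metis prod.collapse)

lemma face_tiling_unique:
  assumes "face_tiling K d I" "\<tau> \<in> K"
    and "(R, \<sigma>) \<in> I" "R \<subseteq> \<tau>" "\<tau> \<subseteq> \<sigma>" and "(R', \<sigma>') \<in> I" "R' \<subseteq> \<tau>" "\<tau> \<subseteq> \<sigma>'"
  shows "R = R'" "\<sigma> = \<sigma>'"
proof -
  have "\<exists>!p. p \<in> I \<and> fst p \<subseteq> \<tau> \<and> \<tau> \<subseteq> snd p"
    using assms(1,2) by (simp add: face_tiling_def)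
  then have "(R, \<sigma>) = (R', \<sigma>')"
    by (rule ex1E) (metis assms(3-8) fst_conv snd_conv)
  then show "R = R'" "\<sigma> = \<sigma>'" by simp_all
qed

definition tile :: "'v set \<Rightarrow> 'v set \<Rightarrow> ('v \<Rightarrow> real) set" where
  "tile R \<sigma> = {x \<in> closed_simplex \<sigma>. R \<subseteq> supp x}"

text \<open>A point of \<open>\<sigma>\<close> lies on the facet opposite to \<open>r\<close> if and only if its coordinate at \<open>r\<close> vanishes.\<close>
lemma basic_tile_tile:
  assumes "finite \<sigma>" "\<sigma> \<in> K" "R \<subseteq> \<sigma>" "card \<sigma> = d + 1"
  shows "basic_tile K d (card R) (tile R \<sigma>)"
proof -
  let ?\<Phi> = "(\<lambda>r. \<sigma> - {r}) ` R"
  have facet: "?\<Phi> \<subseteq> facets \<sigma>"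
    using assms by (auto simp: facets_def)
  have "inj_on (\<lambda>r. \<sigma> - {r}) R"
    using assms by (auto simp: inj_on_def)
  then have card: "card ?\<Phi> = card R"
    by (rule card_image)
  have "x \<in> closed_simplex (\<sigma> - {r}) \<longleftrightarrow> r \<notin> supp x"
    if "x \<in> closed_simplex \<sigma>" "r \<in> R" for x r
  proof -
    have "sum x (\<sigma> - {r}) = sum x \<sigma>" if "r \<notin> supp x"
      using that assms \<open>r \<in> R\<close> by (simp add: sum_diff1 supp_def)
    then show ?thesis using that by (auto simp: closed_simplex_iff)
  qed
  then have "tile R \<sigma> = closed_simplex \<sigma> - (\<Union>\<tau>\<in>?\<Phi>. closed_simplex \<tau>)"
    by (auto simp: tile_def)
  then show ?thesis
    unfolding basic_tile_def using assms facet card by blast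
qed

definition barycenter :: "'v set \<Rightarrow> 'v \<Rightarrow> real" where
  "barycenter \<sigma> v = (if v \<in> \<sigma> then 1 / card \<sigma> else 0)"

lemma barycenter_simplex:
  assumes "finite \<sigma>" "\<sigma> \<noteq> {}"
  shows "barycenter \<sigma> \<in> closed_simplex \<sigma>" "supp (barycenter \<sigma>) = \<sigma>"
  using assms by (simp_all add: closed_simplex_def barycenter_def supp_def)

text \<open>The barycenter of a simplex lies on none of its facets, so no choice of removed facets takes it away.\<close>
lemma basic_tile_barycenter:
  assumes K: "finite_complex K" and T: "basic_tile K d k T"
  obtains \<sigma> where "\<sigma> \<in> K" "card \<sigma> = d + 1" "barycenter \<sigma> \<in> T" "T \<subseteq> closed_simplex \<sigma>"
proof -
  obtain \<sigma> \<Phi> where s: "\<sigma> \<in> K" "card \<sigma> = d + 1" "\<Phi> \<subseteq> facets \<sigma>"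
    "T = closed_simplex \<sigma> - (\<Union>\<tau>\<in>\<Phi>. closed_simplex \<tau>)"
    using T unfolding basic_tile_def by blast
  have fin: "finite \<sigma>" "\<sigma> \<noteq> {}" using finite_complexD(2,3)[OF K] s by blast+
  have "barycenter \<sigma> \<notin> closed_simplex \<tau>" if "\<tau> \<in> \<Phi>" for \<tau>
  proof
    assume "barycenter \<sigma> \<in> closed_simplex \<tau>"
    then have "\<sigma> \<subseteq> \<tau>"
      using barycenter_simplex(2)[OF fin] by (auto simp: closed_simplex_iff)
    moreover have "\<tau> \<subseteq> \<sigma>" "card \<tau> + 1 = card \<sigma>"
      using that s by (auto simp: facets_def)
    ultimately show False by auto
  qed
  then show ?thesis
    using that s barycenter_simplex[OF fin] by auto
qed

text \<open>The simplices of two representations of the same tile contain each other's barycenter,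
  hence coincide.\<close>
lemma basic_tile_dim_unique:
  assumes K: "finite_complex K" and T: "basic_tile K d k T" "basic_tile K d' k' T"
  shows "d = d'"
proof -
  obtain \<sigma> where s: "\<sigma> \<in> K" "card \<sigma> = d + 1" "barycenter \<sigma> \<in> T" "T \<subseteq> closed_simplex \<sigma>"
    using basic_tile_barycenter[OF K T(1)] by metis
  obtain \<sigma>' where s': "\<sigma>' \<in> K" "card \<sigma>' = d' + 1" "barycenter \<sigma>' \<in> T" "T \<subseteq> closed_simplex \<sigma>'"
    using basic_tile_barycenter[OF K T(2)] by metis
  have "finite \<sigma>" "\<sigma> \<noteq> {}" "finite \<sigma>'" "\<sigma>' \<noteq> {}"
    using finite_complexD(2,3)[OF K] s s' by blast+
  then have "\<sigma> = \<sigma>'"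
    using s(3,4) s'(3,4) barycenter_simplex(2)[of \<sigma>] barycenter_simplex(2)[of \<sigma>']
    by (metis closed_simplex_iff subset_antisym subsetD)
  then show ?thesis using s s' by simp
qed

text \<open>All tiles have dimension \<open>d\<close>, so the union of the tiles of dimension at least \<open>j\<close> is either
  everything or empty and hence closed.\<close>
lemma h_tileable_if_face_tiling:
  assumes K: "finite_complex K" and I: "face_tiling K d I"
  shows "h_tileable K"
proof -
  define P where "P = (\<lambda>(R, \<sigma>). tile R \<sigma>) ` I"
  have I1: "R \<subseteq> \<sigma>" "\<sigma> \<in> K" "card \<sigma> = d + 1" "finite \<sigma>" "\<sigma> \<noteq> {}" if "(R, \<sigma>) \<in> I" for R \<sigma>
    using face_tilingD[OF I that] finite_complexD(2,3)[OF K] by auto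
  note poly = polyhedron_iff[OF K finite_complex_vertices[OF K] order_refl]
  have supp_K: "supp x \<in> K" if "x \<in> polyhedron_of K" for x
    using that by (simp add: poly)
  have tile_iff: "x \<in> tile R \<sigma> \<longleftrightarrow> R \<subseteq> supp x \<and> supp x \<subseteq> \<sigma>"
    if x: "x \<in> polyhedron_of K" and p: "(R, \<sigma>) \<in> I" for x R \<sigma>
  proof -
    have 1: "\<forall>v. 0 \<le> x v" "sum x (\<Union>K) = 1" "supp x \<subseteq> \<Union>K"
      using x by (auto simp: poly)
    have "sum x (\<Union>K) = sum x \<sigma>" if "supp x \<subseteq> \<sigma>"
      by (rule sum_eq_if_supp_subset[OF finite_complex_vertices[OF K] 1(3) I1(4)[OF p] that])
    then show ?thesis using 1 by (auto simp: tile_def closed_simplex_iff)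
  qed
  have tile_sub: "tile R \<sigma> \<subseteq> polyhedron_of K" if "(R, \<sigma>) \<in> I" for R \<sigma>
    using I1(2)[OF that] by (auto simp: tile_def polyhedron_of_def)
  have basic: "basic_tile K d (card R) (tile R \<sigma>)" if "(R, \<sigma>) \<in> I" for R \<sigma>
    using I1[OF that] by (intro basic_tile_tile) auto
  have "partition_on (polyhedron_of K) P"
  proof (rule partition_onI)
    have "x \<in> \<Union>P" if x: "x \<in> polyhedron_of K" for x
    proof -
      obtain R \<sigma> where "(R, \<sigma>) \<in> I" "R \<subseteq> supp x" "supp x \<subseteq> \<sigma>"
        using face_tiling_ex[OF I supp_K[OF x]] .
      then show ?thesis using tile_iff[OF x] by (force simp: P_def)
    qed
    then show "\<Union>P = polyhedron_of K" using tile_sub by (auto simp: P_def)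
  next
    fix T T' assume TT: "T \<in> P" "T' \<in> P" "T \<noteq> T'"
    then obtain R \<sigma> R' \<sigma>' where p: "(R, \<sigma>) \<in> I" "T = tile R \<sigma>" "(R', \<sigma>') \<in> I" "T' = tile R' \<sigma>'"
      by (auto simp: P_def)
    have False if "x \<in> T" "x \<in> T'" for x
    proof -
      have x: "x \<in> polyhedron_of K" using that p tile_sub by blast
      have R: "R \<subseteq> supp x" "supp x \<subseteq> \<sigma>" and R': "R' \<subseteq> supp x" "supp x \<subseteq> \<sigma>'"
        using that p tile_iff[OF x] by auto
      have "(R, \<sigma>) = (R', \<sigma>')"
        using face_tiling_unique[OF I supp_K[OF x] p(1) R p(3) R'] by simp
      then show False using TT p by simp
    qed
    then show "disjnt T T'" by (auto simp: disjnt_def)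
  next
    have "barycenter \<sigma> \<in> tile R \<sigma>" if "(R, \<sigma>) \<in> I" for R \<sigma>
      using I1[OF that] barycenter_simplex[of \<sigma>] by (auto simp: tile_def)
    then show "{} \<notin> P"
      by (fastforce simp: P_def)
  qed
  moreover have bt: "\<exists>k. basic_tile K d k T" if "T \<in> P" for T
    using that basic by (auto simp: P_def)
  moreover have "closedin (subtopology (realization K) (polyhedron_of K))
      (\<Union>{T \<in> P. \<exists>e k. j \<le> e \<and> basic_tile K e k T})" for j
  proof -
    have "e = d" if "T \<in> P" "basic_tile K e k T" for T e k
      using bt[OF that(1)] basic_tile_dim_unique[OF K that(2)] by blast
    then have "{T \<in> P. \<exists>e k. j \<le> e \<and> basic_tile K e k T} = (if j \<le> d then P else {})"
      using bt by auto
    moreover have "\<Union>P = topspace (subtopology (realization K) (polyhedron_of K))"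
      using \<open>partition_on (polyhedron_of K) P\<close> by (simp add: partition_on_def realization_eq)
    ultimately show ?thesis
      by (cases "j \<le> d") (simp_all only: if_True if_False Union_empty closedin_empty closedin_topspace)
  qed
  ultimately show ?thesis
    unfolding h_tileable_def h_tiling_def by blast
qed

section \<open>The cross-polytope triangulation of the sphere\<close>

text \<open>The vertices \<open>i\<close> and \<open>i + Suc n\<close> for \<open>i \<le> n\<close> stand for the points \<open>e\<^sub>i\<close> and \<open>-e\<^sub>i\<close>; a set of
  vertices spans a boundary face if and only if it contains no antipodal pair.\<close>
definition cross_polytope :: "nat \<Rightarrow> nat set set" where
  "cross_polytope n =
     {\<tau>. \<tau> \<noteq> {} \<and> \<tau> \<subseteq> {..<2 * Suc n} \<and> (\<forall>i\<le>n. \<not> (i \<in> \<tau> \<and> i + Suc n \<in> \<tau>))}"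

lemma finite_complex_cross_polytope: "finite_complex (cross_polytope n)"
proof -
  have "cross_polytope n \<subseteq> Pow {..<2 * Suc n}" by (auto simp: cross_polytope_def)
  then have "finite (cross_polytope n)" by (rule finite_subset) simp
  then show ?thesis
    unfolding finite_complex_def
    by (auto simp: cross_polytope_def intro: finite_subset[OF _ finite_lessThan])
qed

text \<open>Facets correspond to the sets \<open>N\<close> of negative coordinates. A face lies in the interval
  of \<open>N\<close> if and only if \<open>N\<close> is exactly its set of negative coordinates.\<close>
lemma face_tiling_cross_polytope: "\<exists>I. face_tiling (cross_polytope n) n I"
proof -
  define neg where "neg N = (\<lambda>i. i + Suc n) ` N" for N :: "nat set"
  define full where "full N = ({..n} - N) \<union> neg N" for N :: "nat set"
  define I where "I = {(neg N, full N) | N. N \<subseteq> {..n}}"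
  have memneg: "i \<notin> neg N" "i + Suc n \<in> neg N \<longleftrightarrow> i \<in> N" if "i \<le> n" for i N
    using that by (auto simp: neg_def)
  have props: "neg N \<subseteq> full N \<and> full N \<in> cross_polytope n \<and> card (full N) = n + 1"
    if N: "N \<subseteq> {..n}" for N
  proof (intro conjI)
    show "neg N \<subseteq> full N" by (auto simp: full_def)
    have fin: "finite N" using N finite_subset by blast
    have "card (neg N) = card N"
      unfolding neg_def by (rule card_image) (simp add: inj_on_def)
    moreover have "card ({..n} - N) = Suc n - card N"
      using N fin by (simp add: card_Diff_subset)
    moreover have "card N \<le> Suc n" using card_mono[OF finite_atMost N] by simp
    moreover have "({..n} - N) \<inter> neg N = {}" by (auto simp: neg_def)
    ultimately show c: "card (full N) = n + 1"
      using fin by (simp add: full_def card_Un_disjoint neg_def)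
    then have "full N \<noteq> {}" by auto
    moreover have "full N \<subseteq> {..<2 * Suc n}" using N by (auto simp: full_def neg_def)
    moreover have "\<not> (i \<in> full N \<and> i + Suc n \<in> full N)" if "i \<le> n" for i
      using memneg[OF that] by (auto simp: full_def)
    ultimately show "full N \<in> cross_polytope n" unfolding cross_polytope_def by blast
  qed
  have ex1: "\<exists>R \<sigma>. (R, \<sigma>) \<in> I \<and> R \<subseteq> \<tau> \<and> \<tau> \<subseteq> \<sigma> \<and>
      (\<forall>R' \<sigma>'. (R', \<sigma>') \<in> I \<longrightarrow> R' \<subseteq> \<tau> \<longrightarrow> \<tau> \<subseteq> \<sigma>' \<longrightarrow> R' = R \<and> \<sigma>' = \<sigma>)"
    if t: "\<tau> \<in> cross_polytope n" for \<tau>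
  proof -
    have t': "\<tau> \<subseteq> {..<2 * Suc n}" "\<And>i. i \<le> n \<Longrightarrow> \<not> (i \<in> \<tau> \<and> i + Suc n \<in> \<tau>)"
      using t unfolding cross_polytope_def by blast+
    define N where "N = {i. i \<le> n \<and> i + Suc n \<in> \<tau>}"
    have N: "N \<subseteq> {..n}" by (auto simp: N_def)
    have lower: "neg N \<subseteq> \<tau>" by (auto simp: neg_def N_def)
    have upper: "\<tau> \<subseteq> full N"
    proof
      fix w assume w: "w \<in> \<tau>"
      show "w \<in> full N"
      proof (cases "w \<le> n")
        case True
        then show ?thesis using w t'(2)[of w] by (auto simp: full_def N_def)
      next
        case False
        then have "w - Suc n \<in> N" "w = (w - Suc n) + Suc n"
          using w t'(1) by (auto simp: N_def)
        then show ?thesis unfolding full_def neg_def by blast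
      qed
    qed
    have MN: "M = N" if M: "M \<subseteq> {..n}" "neg M \<subseteq> \<tau>" "\<tau> \<subseteq> full M" for M
    proof -
      have "i \<in> M \<longleftrightarrow> i + Suc n \<in> \<tau>" if "i \<le> n" for i
      proof -
        have "i + Suc n \<in> full M \<longleftrightarrow> i \<in> M"
          using memneg(2)[OF that, of M] by (auto simp: full_def)
        then show ?thesis using memneg(2)[OF that, of M] M by blast
      qed
      then show ?thesis using M(1) by (auto simp: N_def)
    qed
    have "R' = neg N \<and> \<sigma>' = full N" if p: "(R', \<sigma>') \<in> I" "R' \<subseteq> \<tau>" "\<tau> \<subseteq> \<sigma>'" for R' \<sigma>'
    proof -
      obtain M where "M \<subseteq> {..n}" "R' = neg M" "\<sigma>' = full M" using p(1) by (auto simp: I_def)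
      then show ?thesis using MN[of M] p(2,3) by simp
    qed
    moreover have "(neg N, full N) \<in> I" using N by (auto simp: I_def)
    ultimately show ?thesis
      using lower upper by blast
  qed
  have "face_tiling (cross_polytope n) n I"
  proof (rule face_tilingI[OF _ ex1])
    fix R \<sigma> assume "(R, \<sigma>) \<in> I"
    then show "R \<subseteq> \<sigma> \<and> \<sigma> \<in> cross_polytope n \<and> card \<sigma> = n + 1"
      using props unfolding I_def by blast
  qed
  then show ?thesis ..
qed

text \<open>At most one of the coordinates at two antipodal vertices is nonzero. The difference of their
  square roots squares to their sum, so total mass one turns into norm one without any normalisation.\<close>
lemma realization_cross_polytope: "realization (cross_polytope n) homeomorphic_space nsphere n"
proof -
  let ?K = "cross_polytope n"
  define S where "S = {z :: nat \<Rightarrow> real. (\<Sum>i\<le>n. z i ^ 2) = 1 \<and> (\<forall>i>n. z i = 0)}"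
  \<comment> \<open>\<open>f\<close> takes signed square roots, \<open>g\<close> splits a coordinate into its positive and negative part and squares\<close>
  define f where "f x = (\<lambda>i. if i \<le> n then sqrt (x i) - sqrt (x (i + Suc n)) else 0)" for x :: "nat \<Rightarrow> real"
  define g where "g z = (\<lambda>i. if i \<le> n then (max 0 (z i))\<^sup>2
    else if i < 2 * Suc n then (max 0 (- z (i - Suc n)))\<^sup>2 else 0)" for z :: "nat \<Rightarrow> real"
  have V: "\<Union>?K \<subseteq> {..<2 * Suc n}" by (auto simp: cross_polytope_def)
  note iffK = polyhedron_iff[OF finite_complex_cross_polytope finite_lessThan V]
  have sum_split: "sum x {..<2 * Suc n} = (\<Sum>i\<le>n. x i + x (i + Suc n))" for x :: "nat \<Rightarrow> real"
  proof -
    have "sum x {..<2 * Suc n} = sum x {0..<Suc n} + sum x {0 + Suc n..<Suc n + Suc n}"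
      by (simp only: lessThan_atLeast0 mult_2 add_0 sum.atLeastLessThan_concat le_add1 le0)
    also have "sum x {0 + Suc n..<Suc n + Suc n} = (\<Sum>i\<in>{0..<Suc n}. x (i + Suc n))"
      by (rule sum.shift_bounds_nat_ivl)
    finally show ?thesis
      by (simp add: sum.distrib atLeast0LessThan lessThan_Suc_atMost)
  qed
  have poly: "0 \<le> x i" "i \<le> n \<Longrightarrow> x i = 0 \<or> x (i + Suc n) = 0" "2 * Suc n \<le> i \<Longrightarrow> x i = 0"
    "(\<Sum>i\<le>n. x i + x (i + Suc n)) = 1" if "x \<in> polyhedron_of ?K" for x i
  proof -
    have x: "\<forall>v. 0 \<le> x v" "supp x \<in> ?K" "sum x {..<2 * Suc n} = 1"
      using that unfolding iffK by blast+
    then show "0 \<le> x i" "(\<Sum>i\<le>n. x i + x (i + Suc n)) = 1" by (simp_all only: sum_split)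
    have "supp x \<subseteq> {..<2 * Suc n}" "\<forall>i\<le>n. \<not> (i \<in> supp x \<and> i + Suc n \<in> supp x)"
      using x(2) unfolding cross_polytope_def by blast+
    then show "i \<le> n \<Longrightarrow> x i = 0 \<or> x (i + Suc n) = 0" "2 * Suc n \<le> i \<Longrightarrow> x i = 0"
      by (auto simp: supp_def)
  qed
  have f_into: "f x \<in> S" if x: "x \<in> polyhedron_of ?K" for x
  proof -
    have "(f x i)\<^sup>2 = x i + x (i + Suc n)" if "i \<le> n" for i
      using poly(2)[OF x that] poly(1)[OF x] that by (auto simp: f_def)
    then have "(\<Sum>i\<le>n. (f x i)\<^sup>2) = 1"
      using poly(4)[OF x] by simp
    then show ?thesis by (simp add: S_def f_def)
  qed
  have g_into: "g z \<in> polyhedron_of ?K" if z: "z \<in> S" for z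
  proof -
    have "g z i + g z (i + Suc n) = (z i)\<^sup>2" if "i \<le> n" for i
      using that by (auto simp: g_def max_def)
    then have sum: "sum (g z) {..<2 * Suc n} = 1"
      using z unfolding sum_split by (simp add: S_def)
    moreover have "supp (g z) \<noteq> {}"
    proof
      assume "supp (g z) = {}"
      then have "sum (g z) {..<2 * Suc n} = 0" by (intro sum.neutral) (auto simp: supp_def)
      then show False using sum by simp
    qed
    moreover have "supp (g z) \<subseteq> {..<2 * Suc n}"
      by (auto simp: supp_def g_def split: if_splits)
    moreover have "\<not> (i \<in> supp (g z) \<and> i + Suc n \<in> supp (g z))" if "i \<le> n" for i
      using that by (auto simp: supp_def g_def max_def split: if_splits)
    ultimately have "supp (g z) \<in> ?K" unfolding cross_polytope_def by blast
    then show ?thesis using sum unfolding iffK by (auto simp: g_def)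
  qed
  have gf: "g (f x) = x" if x: "x \<in> polyhedron_of ?K" for x
  proof
    fix i
    consider "i \<le> n" | j where "j \<le> n" "i = j + Suc n" | "2 * Suc n \<le> i"
    proof (cases "i \<le> n \<or> 2 * Suc n \<le> i")
      case False
      then show thesis using that(2)[of "i - Suc n"] by auto
    qed (use that in auto)
    then show "g (f x) i = x i"
    proof cases
      case 1
      then show ?thesis using poly(2)[OF x 1] poly(1)[OF x] by (auto simp: g_def f_def)
    next
      case 2
      then show ?thesis using poly(2)[OF x 2(1)] poly(1)[OF x] by (auto simp: g_def f_def)
    next
      case 3
      then show ?thesis using poly(3)[OF x 3] by (simp add: g_def)
    qed
  qed
  have fg: "f (g z) = z" if z: "z \<in> S" for z
  proof
    fix i
    show "f (g z) i = z i"
      using z by (cases "i \<le> n") (auto simp: f_def g_def S_def max_def)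
  qed
  have coord: "continuous_on T (\<lambda>x. x i)" for T :: "(nat \<Rightarrow> real) set" and i
    by (rule continuous_on_subset[OF continuous_on_product_coordinates subset_UNIV])
  have contf: "continuous_on T f" for T
  proof (rule continuous_on_coordinatewise_then_product)
    show "continuous_on T (\<lambda>x. f x i)" for i
      by (cases "i \<le> n") (auto simp: f_def intro!: continuous_on_diff continuous_on_real_sqrt coord)
  qed
  have contg: "continuous_on T g" for T
  proof (rule continuous_on_coordinatewise_then_product)
    show "continuous_on T (\<lambda>x. g x i)" for i
      by (cases "i \<le> n"; cases "i < 2 * Suc n")
         (auto simp: g_def intro!: continuous_on_power continuous_on_max continuous_on_minus coord)
  qed
  have "nsphere n = top_of_set S"
    by (simp add: nsphere S_def euclidean_product_topology)
  moreover have "homeomorphic_maps (realization ?K) (top_of_set S) f g"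
    unfolding homeomorphic_maps_def realization_eq continuous_map_subtopology_eu
    using contf contg f_into g_into gf fg by auto
  ultimately show ?thesis by (auto simp: homeomorphic_space_def)
qed

section \<open>The four-cycle and products with it\<close>

abbreviation next4 :: "nat \<Rightarrow> nat" where
  "next4 a \<equiv> Suc a mod 4"

text \<open>Length four is enough for the direction of an edge to be determined by its two vertices:
  going two steps ahead never leads back.\<close>
lemma next4_cycle: "a < 4 \<Longrightarrow> next4 a < 4" "a < 4 \<Longrightarrow> next4 a \<noteq> a" "a < 4 \<Longrightarrow> next4 (next4 a) \<noteq> a"
  by (auto simp: mod_Suc split: if_splits)

text \<open>The one-dimensional cross-polytope is the cycle 0, 1, 2, 3. The witness \<open>a\<close> is the tail of the
  edge, or the vertex itself; it is unique.\<close>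
lemma cross_polytope_1_iff:
  "\<tau> \<in> cross_polytope 1 \<longleftrightarrow> (\<exists>a<4. a \<in> \<tau> \<and> \<tau> \<subseteq> {a, next4 a})"
proof
  assume "\<tau> \<in> cross_polytope 1"
  then have 1: "\<tau> \<noteq> {}" "\<tau> \<subseteq> {..<4}" and anti: "\<And>i. i \<le> 1 \<Longrightarrow> \<not> (i \<in> \<tau> \<and> i + 2 \<in> \<tau>)"
    by (simp_all add: cross_polytope_def)
  moreover have "{..<4} = {0, 1, 2, 3::nat}" by auto
  ultimately have t: "\<tau> \<noteq> {}" "\<tau> \<subseteq> {0, 1, 2, 3}" "0 \<notin> \<tau> \<or> 2 \<notin> \<tau>" "1 \<notin> \<tau> \<or> 3 \<notin> \<tau>"
    using anti[of 0] anti[of 1] by (simp_all add: numeral_eq_Suc)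
  consider "0 \<in> \<tau>" "3 \<notin> \<tau>" | "1 \<in> \<tau>" "0 \<notin> \<tau>" | "2 \<in> \<tau>" "1 \<notin> \<tau>" | "3 \<in> \<tau>" "2 \<notin> \<tau>"
    using t by auto
  then show "\<exists>a<4. a \<in> \<tau> \<and> \<tau> \<subseteq> {a, next4 a}"
  proof cases
    case 1 then show ?thesis using t by (intro exI[of _ 0]) auto
  next
    case 2 then show ?thesis using t by (intro exI[of _ 1]) auto
  next
    case 3 then show ?thesis using t by (intro exI[of _ 2]) auto
  next
    case 4 then show ?thesis using t by (intro exI[of _ 3]) auto
  qed
next
  assume "\<exists>a<4. a \<in> \<tau> \<and> \<tau> \<subseteq> {a, next4 a}"
  then obtain a where a: "a < 4" "a \<in> \<tau>" "\<tau> \<subseteq> {a, next4 a}" by blast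
  have "\<not> (i \<in> \<tau> \<and> i + 2 \<in> \<tau>)" if "i \<le> 1" for i
  proof
    assume "i \<in> \<tau> \<and> i + 2 \<in> \<tau>"
    then have "i \<in> {a, next4 a}" "i + 2 \<in> {a, next4 a}" using a(3) by blast+
    then have "i = a \<and> i + 2 = next4 a \<or> i = next4 a \<and> i + 2 = a" by auto
    then show False using a(1) that by (auto simp: mod_Suc split: if_splits)
  qed
  moreover have "\<tau> \<subseteq> {..<4}" using a next4_cycle(1)[OF a(1)] by auto
  ultimately show "\<tau> \<in> cross_polytope 1"
    using a by (auto simp: cross_polytope_def)
qed

text \<open>The product of ordered simplicial complexes: a simplex is a set of pairs that projects to
  simplices and is weakly increasing in both factors, the order on the edges of the cycle being their
  direction. Imposing monotonicity on all \<open>a\<close> at once is harmless, as the levels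
  occurring in a simplex lie on a single edge, and makes the definition independent of the edge.\<close>
definition circle_product :: "'v::linorder set set \<Rightarrow> ('v \<times> nat) set set" where
  "circle_product K = {\<tau>. fst ` \<tau> \<in> K \<and> snd ` \<tau> \<in> cross_polytope 1 \<and>
     (\<forall>u v a. (u, a) \<in> \<tau> \<and> (v, next4 a) \<in> \<tau> \<longrightarrow> u \<le> v)}"

lemma circle_productI:
  assumes "fst ` \<tau> \<in> K" "snd ` \<tau> \<in> cross_polytope 1"
    and "\<And>u v a. (u, a) \<in> \<tau> \<Longrightarrow> (v, next4 a) \<in> \<tau> \<Longrightarrow> u \<le> v"
  shows "\<tau> \<in> circle_product K"
  using assms unfolding circle_product_def by blast

lemma circle_product_vertices: "\<Union>(circle_product K) \<subseteq> \<Union>K \<times> {..<4}"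
proof
  fix w assume "w \<in> \<Union>(circle_product K)"
  then obtain \<tau> where t: "w \<in> \<tau>" "fst ` \<tau> \<in> K" "snd ` \<tau> \<in> cross_polytope 1"
    by (auto simp: circle_product_def)
  then have "snd ` \<tau> \<subseteq> {..<4}" by (simp add: cross_polytope_def)
  then have "fst w \<in> \<Union>K" "snd w < 4" using t by blast+
  then show "w \<in> \<Union>K \<times> {..<4}" by (cases w) auto
qed

lemma finite_complex_circle_product:
  assumes K: "finite_complex K"
  shows "finite_complex (circle_product K)"
proof -
  have fin: "finite (\<Union>K \<times> {..<4::nat})"
    using finite_complex_vertices[OF K] by simp
  have sub: "circle_product K \<subseteq> Pow (\<Union>K \<times> {..<4})"
    using circle_product_vertices[of K] by blast
  have "finite (circle_product K)"
    using sub fin by (simp add: finite_subset)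
  moreover have "finite \<tau> \<and> \<tau> \<noteq> {}" if "\<tau> \<in> circle_product K" for \<tau>
  proof
    show "finite \<tau>" using that sub fin finite_subset by blast
    show "\<tau> \<noteq> {}" using that by (auto simp: circle_product_def cross_polytope_def)
  qed
  moreover have "\<tau>' \<in> circle_product K" if t: "\<tau> \<in> circle_product K" "\<tau>' \<subseteq> \<tau>" "\<tau>' \<noteq> {}" for \<tau> \<tau>'
  proof -
    have "fst ` \<tau>' \<in> K"
      using t finite_complexD(4)[OF K, of "fst ` \<tau>"] by (auto simp: circle_product_def image_mono)
    moreover have "snd ` \<tau>' \<in> cross_polytope 1"
      using t finite_complexD(4)[OF finite_complex_cross_polytope, of "snd ` \<tau>"]
      by (auto simp: circle_product_def image_mono)
    moreover have "u \<le> v" if "(u, a) \<in> \<tau>'" "(v, next4 a) \<in> \<tau>'" for u v a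
      using that t(1,2) unfolding circle_product_def by blast
    ultimately show ?thesis unfolding circle_product_def by blast
  qed
  ultimately show ?thesis unfolding finite_complex_def by blast
qed

section \<open>Staircase coordinates\<close>

text \<open>A point in the prism over a simplex is a pair \<open>(p, q)\<close> of mass distributions on its vertices, on
  the lower and on the upper level. Along a staircase the lower mass is used up before the upper
  one sets in, so every initial segment carries as much lower mass as possible: all its
  mass or all the lower mass, whichever is smaller.\<close>
lemma staircase_prefix_sum:
  fixes p q :: "'v::linorder \<Rightarrow> real"
  assumes V: "finite V" and nonneg: "\<And>v. v \<in> V \<Longrightarrow> 0 \<le> p v" "\<And>v. v \<in> V \<Longrightarrow> 0 \<le> q v"
    and stair: "\<And>u v. u \<in> V \<Longrightarrow> v \<in> V \<Longrightarrow> p u \<noteq> 0 \<Longrightarrow> q v \<noteq> 0 \<Longrightarrow> u \<le> v"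
    and D: "D \<subseteq> V" "\<And>u v. u \<in> D \<Longrightarrow> v \<in> V - D \<Longrightarrow> u < v"
  shows "sum p D = min (\<Sum>v\<in>D. p v + q v) (sum p V)"
proof -
  have finD: "finite D" using V D finite_subset by blast
  have le: "sum p D \<le> sum p V" "sum p D \<le> (\<Sum>v\<in>D. p v + q v)"
    using V D nonneg by (auto intro!: sum_mono2 sum_mono)
  show ?thesis
  proof (cases "\<exists>w\<in>V - D. p w \<noteq> 0")
    case True
    then obtain w where w: "w \<in> V - D" "p w \<noteq> 0" by blast
    have "q v = 0" if "v \<in> D" for v
      using that w D stair[of w v] by force
    then show ?thesis using le by simp
  next
    case False
    then have "sum p V = sum p D"
      using V D by (intro sum.mono_neutral_right) auto
    then show ?thesis using le by simp
  qed
qed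

text \<open>The prefix sums of \<open>p\<close> are functions of the marginals, and \<open>p v\<close> is the difference of the
  prefix sums up to and before \<open>v\<close>.\<close>
lemma staircase_unique:
  fixes p q p' q' :: "'v::linorder \<Rightarrow> real"
  assumes V: "finite V"
    and p: "\<And>v. v \<in> V \<Longrightarrow> 0 \<le> p v" "\<And>v. v \<in> V \<Longrightarrow> 0 \<le> q v"
      "\<And>u v. u \<in> V \<Longrightarrow> v \<in> V \<Longrightarrow> p u \<noteq> 0 \<Longrightarrow> q v \<noteq> 0 \<Longrightarrow> u \<le> v"
    and p': "\<And>v. v \<in> V \<Longrightarrow> 0 \<le> p' v" "\<And>v. v \<in> V \<Longrightarrow> 0 \<le> q' v"
      "\<And>u v. u \<in> V \<Longrightarrow> v \<in> V \<Longrightarrow> p' u \<noteq> 0 \<Longrightarrow> q' v \<noteq> 0 \<Longrightarrow> u \<le> v"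
    and eq: "\<And>v. v \<in> V \<Longrightarrow> p v + q v = p' v + q' v" "sum p V = sum p' V"
    and v: "v \<in> V"
  shows "p v = p' v"
proof -
  have prefix: "sum p D = sum p' D"
    if D: "D \<subseteq> V" "\<And>u v. u \<in> D \<Longrightarrow> v \<in> V - D \<Longrightarrow> u < v" for D
  proof -
    have "(\<Sum>v\<in>D. p v + q v) = (\<Sum>v\<in>D. p' v + q' v)"
      using D(1) eq(1) by (intro sum.cong) auto
    moreover have "sum p D = min (\<Sum>v\<in>D. p v + q v) (sum p V)"
      by (rule staircase_prefix_sum[OF V p D])
    moreover have "sum p' D = min (\<Sum>v\<in>D. p' v + q' v) (sum p' V)"
      by (rule staircase_prefix_sum[OF V p' D])
    ultimately show ?thesis using eq(2) by simp
  qed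
  have ins: "{u \<in> V. u \<le> v} = insert v {u \<in> V. u < v}" using v by auto
  have "sum p {u \<in> V. u \<le> v} = sum p' {u \<in> V. u \<le> v}"
    by (rule prefix) auto
  moreover have "sum p {u \<in> V. u < v} = sum p' {u \<in> V. u < v}"
    by (rule prefix) auto
  ultimately show ?thesis
    using V by (simp add: ins)
qed

text \<open>The lower mass \<open>t\<close> is distributed greedily from the smallest vertex on. In the induction, the
  largest vertex receives what exceeds the capacity of the others.\<close>
lemma staircase_exists:
  fixes y :: "'v::linorder \<Rightarrow> real"
  assumes "finite V" "\<And>v. v \<in> V \<Longrightarrow> 0 \<le> y v" "0 \<le> t" "t \<le> sum y V"
  shows "\<exists>p. (\<forall>v\<in>V. 0 \<le> p v \<and> p v \<le> y v) \<and> sum p V = t \<and>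
    (\<forall>u\<in>V. \<forall>v\<in>V. p u \<noteq> 0 \<and> p v \<noteq> y v \<longrightarrow> u \<le> v)"
  using assms
proof (induction V rule: finite_linorder_max_induct)
  case empty
  then show ?case by simp
next
  case (insert m V)
  have notin: "m \<notin> V" using insert.hyps by blast
  show ?case
  proof (cases "t \<le> sum y V")
    case True
    obtain p where p: "\<forall>v\<in>V. 0 \<le> p v \<and> p v \<le> y v" "sum p V = t"
      "\<forall>u\<in>V. \<forall>v\<in>V. p u \<noteq> 0 \<and> p v \<noteq> y v \<longrightarrow> u \<le> v"
      using insert.IH True insert.prems by auto
    have "sum (p(m := 0)) V = sum p V"
      using notin by (intro sum.cong) auto
    then have "sum (p(m := 0)) (insert m V) = t"
      using notin insert.hyps(1) p(2) by simp
    then show ?thesis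
      using p(1,3) insert.prems insert.hyps(2) notin
      by (intro exI[of _ "p(m := 0)"]) (auto intro: less_imp_le)
  next
    case False
    have "sum (y(m := t - sum y V)) V = sum y V"
      using notin by (intro sum.cong) auto
    then have "sum (y(m := t - sum y V)) (insert m V) = t"
      using notin insert.hyps(1) by simp
    then show ?thesis
      using False insert.prems insert.hyps notin
      by (intro exI[of _ "y(m := t - sum y V)"]) (auto intro: less_imp_le)
  qed
qed

lemma supp_marginals:
  fixes x :: "'v \<times> 'w \<Rightarrow> real"
  assumes "finite A" "finite B" "supp x \<subseteq> A \<times> B" "\<And>w. 0 \<le> x w"
  shows "supp (\<lambda>v. \<Sum>a\<in>B. x (v, a)) = fst ` supp x"
    and "supp (\<lambda>a. \<Sum>v\<in>A. x (v, a)) = snd ` supp x"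
proof -
  have 1: "(\<Sum>a\<in>B. x (v, a)) \<noteq> 0 \<longleftrightarrow> (\<exists>a\<in>B. x (v, a) \<noteq> 0)" for v
    using assms by (simp add: sum_nonneg_eq_0_iff)
  have 2: "(\<Sum>v\<in>A. x (v, a)) \<noteq> 0 \<longleftrightarrow> (\<exists>v\<in>A. x (v, a) \<noteq> 0)" for a
    using assms by (simp add: sum_nonneg_eq_0_iff)
  have mem: "v \<in> A \<and> a \<in> B" if "x (v, a) \<noteq> 0" for v a
    using that assms(3) by (auto simp: supp_def)
  show "supp (\<lambda>v. \<Sum>a\<in>B. x (v, a)) = fst ` supp x"
    unfolding set_eq_iff in_supp 1 using mem by (force simp: in_supp image_iff)
  show "supp (\<lambda>a. \<Sum>v\<in>A. x (v, a)) = snd ` supp x"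
    unfolding set_eq_iff in_supp 2 using mem by (force simp: in_supp image_iff)
qed

text \<open>The two projections are the marginals of the coordinates. A point is recovered from its
  marginals as the unique solution of a transportation problem along the staircase. For injectivity it
  matters that the edge of the cycle can be read off from the second marginal, so that the same
  edge may be used for both points.\<close>
lemma realization_circle_product:
  fixes K :: "'v::linorder set set"
  assumes K: "finite_complex K"
  shows "realization (circle_product K) homeomorphic_space
    prod_topology (realization K) (realization (cross_polytope 1))"
proof -
  let ?L = "cross_polytope 1"
  define V where "V = \<Union>K"
  define f :: "('v \<times> nat \<Rightarrow> real) \<Rightarrow> ('v \<Rightarrow> real) \<times> (nat \<Rightarrow> real)" where
    "f x = (\<lambda>v. \<Sum>a\<in>{..<4}. x (v, a), \<lambda>a. \<Sum>v\<in>V. x (v, a))" for x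
  have V: "finite V" "\<Union>K \<subseteq> V" using finite_complex_vertices[OF K] by (auto simp: V_def)
  have L4: "\<Union>?L \<subseteq> {..<4}" by (auto simp: cross_polytope_def)
  have VxL: "finite (V \<times> {..<4::nat})" using V(1) by simp
  note iffK = polyhedron_iff[OF K V]
  note iffL = polyhedron_iff[OF finite_complex_cross_polytope finite_lessThan L4]
  note iffP = polyhedron_iff[OF finite_complex_circle_product[OF K] VxL
      circle_product_vertices[of K, folded V_def]]
  have nonneg: "0 \<le> x w" if "x \<in> polyhedron_of (circle_product K)" for x w
    using that unfolding iffP by blast
  have supp_in: "supp x \<in> circle_product K" if "x \<in> polyhedron_of (circle_product K)" for x
    using that unfolding iffP by blast
  have supp_VL: "supp x \<subseteq> V \<times> {..<4}" if "x \<in> polyhedron_of (circle_product K)" for x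
    using supp_in[OF that] circle_product_vertices[of K, folded V_def] by blast
  have supp_f: "supp (fst (f x)) = fst ` supp x" "supp (snd (f x)) = snd ` supp x"
    if "x \<in> polyhedron_of (circle_product K)" for x
    using supp_marginals[OF V(1) finite_lessThan supp_VL[OF that] nonneg[OF that]]
    by (simp_all add: f_def)
  have f_into: "f x \<in> polyhedron_of K \<times> polyhedron_of ?L"
    if x: "x \<in> polyhedron_of (circle_product K)" for x
  proof -
    have "sum x (V \<times> {..<4}) = 1"
      using x unfolding iffP by blast
    then have 1: "(\<Sum>v\<in>V. \<Sum>a<4. x (v, a)) = 1"
      by (simp add: sum.cartesian_product)
    then have "sum (fst (f x)) V = 1" "sum (snd (f x)) {..<4} = 1"
      by (simp_all add: f_def sum.swap[of _ "{..<4}" V])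
    moreover have "supp (fst (f x)) \<in> K" "supp (snd (f x)) \<in> ?L"
      using supp_in[OF x] unfolding supp_f[OF x] circle_product_def by blast+
    moreover have "0 \<le> fst (f x) v" "0 \<le> snd (f x) a" for v a
      using nonneg[OF x] by (auto simp: f_def intro!: sum_nonneg)
    ultimately show ?thesis
      unfolding mem_Times_iff iffK iffL by blast
  qed
  have cont: "continuous_map (realization (circle_product K))
      (prod_topology (realization K) (realization ?L)) f"
  proof -
    have coord: "continuous_on S (\<lambda>x. x w)" for S :: "('v \<times> nat \<Rightarrow> real) set" and w
      by (rule continuous_on_subset[OF continuous_on_product_coordinates subset_UNIV])
    have 1: "continuous_on S (\<lambda>x v. \<Sum>a\<in>{..<4}. x (v, a))" for S :: "('v \<times> nat \<Rightarrow> real) set"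
      by (rule continuous_on_coordinatewise_then_product, rule continuous_on_sum, rule coord)
    have 2: "continuous_on S (\<lambda>x a. \<Sum>v\<in>V. x (v, a))" for S :: "('v \<times> nat \<Rightarrow> real) set"
      by (rule continuous_on_coordinatewise_then_product, rule continuous_on_sum, rule coord)
    have "continuous_on (polyhedron_of (circle_product K)) f"
      unfolding f_def by (rule continuous_on_Pair[OF 1 2])
    then show ?thesis
      using f_into
      unfolding realization_eq prod_topology_subtopology_eu continuous_map_subtopology_eu by blast
  qed
  have inj: "inj_on f (polyhedron_of (circle_product K))"
  proof (rule inj_onI)
    fix x x' assume x: "x \<in> polyhedron_of (circle_product K)"
      and x': "x' \<in> polyhedron_of (circle_product K)" and eq: "f x = f x'"
    have "snd ` supp x \<in> ?L" using supp_in[OF x] by (simp add: circle_product_def)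
    then obtain a where a: "a < 4" "snd ` supp x \<subseteq> {a, next4 a}"
      unfolding cross_polytope_1_iff by blast
    define b where "b = next4 a"
    have b: "b < 4" "b \<noteq> a" using next4_cycle[OF a(1)] by (auto simp: b_def)
    \<comment> \<open>the supports of \<open>x\<close> and \<open>x'\<close> have the same levels because the second marginals agree\<close>
    have sup: "snd ` supp x \<subseteq> {a, b}" "snd ` supp x' \<subseteq> {a, b}"
      using a(2) supp_f[OF x] supp_f[OF x'] eq by (auto simp: b_def)
    have zero: "z (v, c) = 0"
      if "snd ` supp z \<subseteq> {a, b}" "c \<noteq> a" "c \<noteq> b" for z :: "'v \<times> nat \<Rightarrow> real" and v c
      using that by (force simp: supp_def image_iff)
    have marg: "fst (f z) v = z (v, a) + z (v, b)"
      if "snd ` supp z \<subseteq> {a, b}" for z v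
    proof -
      have "(\<Sum>c\<in>{..<4}. z (v, c)) = (\<Sum>c\<in>{a, b}. z (v, c))"
        using a(1) b zero[OF that] by (intro sum.mono_neutral_right) auto
      then show ?thesis using b by (simp add: f_def)
    qed
    have stair: "u \<le> v" if "z \<in> polyhedron_of (circle_product K)" "z (u, a) \<noteq> 0" "z (v, b) \<noteq> 0" for z u v
      using supp_in[OF that(1)] that(2,3) unfolding circle_product_def b_def in_supp[symmetric] by blast
    have sum_ab: "x (v, a) + x (v, b) = x' (v, a) + x' (v, b)" for v
      using eq marg[OF sup(1)] marg[OF sup(2)] by metis
    have "(\<Sum>v\<in>V. x (v, a)) = (\<Sum>v\<in>V. x' (v, a))"
      using eq by (auto simp: f_def dest: fun_cong[of _ _ a])
    then have xa: "x (v, a) = x' (v, a)" if "v \<in> V" for v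
      using staircase_unique[of V "\<lambda>v. x (v, a)" "\<lambda>v. x (v, b)" "\<lambda>v. x' (v, a)" "\<lambda>v. x' (v, b)" v]
        V(1) nonneg[OF x] nonneg[OF x'] stair[OF x] stair[OF x'] sum_ab that by blast
    have "x (v, c) = x' (v, c)" for v c
    proof (cases "v \<in> V")
      case True
      then show ?thesis
        using xa[OF True] sum_ab[of v] zero[OF sup(1), of c v] zero[OF sup(2), of c v]
        by (cases "c = a"; cases "c = b") auto
    next
      case False
      then have "(v, c) \<notin> supp x" "(v, c) \<notin> supp x'" using supp_VL[OF x] supp_VL[OF x'] by auto
      then show ?thesis by (simp add: in_supp)
    qed
    then show "x = x'" by (auto simp: fun_eq_iff)
  qed
  have surj: "\<exists>x \<in> polyhedron_of (circle_product K). f x = (y, t)"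
    if y: "y \<in> polyhedron_of K" and t: "t \<in> polyhedron_of ?L" for y t
  proof -
    have tL: "\<And>c. 0 \<le> t c" "supp t \<in> ?L" "sum t {..<4} = 1"
      using t unfolding iffL by blast+
    have yK: "\<And>v. 0 \<le> y v" "supp y \<in> K" "sum y V = 1"
      using y unfolding iffK by blast+
    obtain a where a: "a < 4" "supp t \<subseteq> {a, next4 a}"
      using tL(2) unfolding cross_polytope_1_iff by blast
    define b where "b = next4 a"
    have b: "b < 4" "b \<noteq> a" "next4 b \<noteq> a" using next4_cycle[OF a(1)] by (auto simp: b_def)
    have t0: "t c = 0" if "c \<noteq> a" "c \<noteq> b" for c
      using a(2) that by (auto simp: supp_def b_def)
    have y0: "y v = 0" if "v \<notin> V" for v
      using yK(2) V(2) that by (auto simp: supp_def)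
    have "sum t {..<4} = (\<Sum>c\<in>{a, b}. t c)"
      using a(1) b t0 by (intro sum.mono_neutral_right) auto
    then have tab: "t a + t b = 1" "0 \<le> t a" "0 \<le> t b"
      using tL b by simp_all
    obtain p where p: "\<forall>v\<in>V. 0 \<le> p v \<and> p v \<le> y v" "sum p V = t a"
      "\<forall>u\<in>V. \<forall>v\<in>V. p u \<noteq> 0 \<and> p v \<noteq> y v \<longrightarrow> u \<le> v"
      using staircase_exists[of V y "t a"] V(1) yK(1,3) tab by auto
    define x where "x = (\<lambda>(v, c). if v \<notin> V then 0 else if c = a then p v
      else if c = b then y v - p v else 0)"
    have xa: "x (v, a) = p v" "x (v, b) = y v - p v" if "v \<in> V" for v
      using that b by (auto simp: x_def)
    have x0: "x (v, c) = 0" if "c \<noteq> a" "c \<noteq> b" for v c using that by (simp add: x_def)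
    have xnn: "0 \<le> x w" for w
      using p(1) by (cases w) (auto simp: x_def)
    have xsupp: "supp x \<subseteq> V \<times> {a, b}"
      by (auto simp: supp_def x_def split: if_splits)
    then have xsupp4: "supp x \<subseteq> V \<times> {..<4}" using a(1) b by auto
    have fx: "f x = (y, t)"
    proof -
      have "(\<Sum>c\<in>{..<4}. x (v, c)) = y v" for v
      proof (cases "v \<in> V")
        case True
        have "(\<Sum>c\<in>{..<4}. x (v, c)) = (\<Sum>c\<in>{a, b}. x (v, c))"
          using a(1) b x0 by (intro sum.mono_neutral_right) auto
        then show ?thesis using xa[OF True] b by simp
      qed (simp add: x_def y0)
      moreover have "(\<Sum>v\<in>V. x (v, c)) = t c" for c
      proof -
        consider "c = a" | "c = b" | "c \<noteq> a" "c \<noteq> b" by blast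
        then show ?thesis
        proof cases
          case 1 then show ?thesis using p(2) xa by simp
        next
          case 2
          then have "(\<Sum>v\<in>V. x (v, c)) = sum y V - sum p V"
            using xa by (simp add: sum_subtractf)
          then show ?thesis using 2 p(2) yK(3) tab(1) by simp
        next
          case 3 then show ?thesis using x0 t0 by simp
        qed
      qed
      ultimately show ?thesis by (simp add: f_def)
    qed
    have sup: "fst ` supp x = supp y" "snd ` supp x = supp t"
      using supp_marginals[OF V(1) finite_lessThan xsupp4 xnn] fx by (auto simp: f_def)
    have "u \<le> v" if uv: "(u, c) \<in> supp x" "(v, next4 c) \<in> supp x" for u v c
    proof -
      have mem: "u \<in> V" "v \<in> V" "c \<in> {a, b}" "next4 c \<in> {a, b}" using uv xsupp by auto
      then have "c = a" using b next4_cycle(2)[OF b(1)] by auto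
      then show ?thesis using mem uv xa p(3) b by (auto simp: in_supp b_def)
    qed
    then have "supp x \<in> circle_product K"
      using yK(2) tL(2) unfolding circle_product_def sup[symmetric] by blast
    moreover have "sum x (V \<times> {..<4}) = 1"
    proof -
      have "sum x (V \<times> {..<4}) = sum (fst (f x)) V"
        by (simp add: f_def sum.cartesian_product)
      then show ?thesis using fx yK(3) by simp
    qed
    ultimately have "x \<in> polyhedron_of (circle_product K)"
      using xnn unfolding iffP by blast
    then show ?thesis using fx by blast
  qed
  have "homeomorphic_map (realization (circle_product K))
      (prod_topology (realization K) (realization ?L)) f"
  proof (rule continuous_imp_homeomorphic_map[OF cont])
    show "compact_space (realization (circle_product K))"
      by (intro compact_space_realization finite_complex_circle_product K)
    show "Hausdorff_space (prod_topology (realization K) (realization ?L))"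
      by (simp add: Hausdorff_space_prod_topology Hausdorff_space_realization)
    show "inj_on f (topspace (realization (circle_product K)))"
      using inj by (simp add: realization_eq)
    have "f ` polyhedron_of (circle_product K) = polyhedron_of K \<times> polyhedron_of ?L"
    proof
      show "f ` polyhedron_of (circle_product K) \<subseteq> polyhedron_of K \<times> polyhedron_of ?L"
        using f_into by blast
      show "polyhedron_of K \<times> polyhedron_of ?L \<subseteq> f ` polyhedron_of (circle_product K)"
        using surj by force
    qed
    then show "f ` topspace (realization (circle_product K)) =
        topspace (prod_topology (realization K) (realization ?L))"
      by (simp add: realization_eq)
  qed
  then show ?thesis by (rule homeomorphic_map_imp_homeomorphic_space)
qed

section \<open>Tiling the product with a circle\<close>

text \<open>For \<open>(R, \<sigma>)\<close> in the given tiling, \<open>v \<in> \<sigma>\<close> and the edge starting at \<open>a\<close>, the staircase steps up at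
  \<open>v\<close>. Its tile must project into the tile of \<open>(R, \<sigma>)\<close>, which forces the level of each \<open>r \<in> R\<close> other
  than \<open>v\<close>, and must contain \<open>(v, a)\<close>. A face of the product recovers \<open>a\<close> as the tail of its
  edge, \<open>v\<close> as its largest vertex on level \<open>a\<close>, and \<open>(R, \<sigma>)\<close> as the tile of its projection.\<close>
lemma face_tiling_circle_product:
  fixes K :: "'v::linorder set set"
  assumes K: "finite_complex K" and I: "face_tiling K d I"
  shows "\<exists>J. face_tiling (circle_product K) (Suc d) J"
proof -
  define lo where "lo R v a = insert (v, a) ({r \<in> R. r < v} \<times> {a} \<union> {r \<in> R. v < r} \<times> {next4 a})"
    for R :: "'v set" and v and a :: nat
  \<comment> \<open>the interval from \<open>lo R v a\<close> to \<open>up \<sigma> v a\<close> is the tile over \<open>(R, \<sigma>)\<close> of the staircase on the edge from \<open>a\<close> that steps up at \<open>v\<close>\<close>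
  define up where "up \<sigma> v a = {u \<in> \<sigma>. u \<le> v} \<times> {a} \<union> {u \<in> \<sigma>. v \<le> u} \<times> {next4 a}"
    for \<sigma> :: "'v set" and v and a :: nat
  define J where "J = {(lo R v a, up \<sigma> v a) | R \<sigma> v a. (R, \<sigma>) \<in> I \<and> v \<in> \<sigma> \<and> a < 4}"
  have props: "lo R v a \<subseteq> up \<sigma> v a \<and> up \<sigma> v a \<in> circle_product K \<and> card (up \<sigma> v a) = Suc d + 1"
    if p: "(R, \<sigma>) \<in> I" "v \<in> \<sigma>" "a < 4" for R \<sigma> v a
  proof (intro conjI)
    note s = face_tilingD[OF I p(1)]
    note n4 = next4_cycle[OF p(3)]
    have fin: "finite \<sigma>" using s K by (simp add: finite_complexD(2))
    show "lo R v a \<subseteq> up \<sigma> v a"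
      using s(1) p(2) by (auto simp: lo_def up_def)
    have "fst ` up \<sigma> v a = \<sigma>"
      by (auto simp: up_def image_Un)
    moreover have "(v, a) \<in> up \<sigma> v a" "snd ` up \<sigma> v a \<subseteq> {a, next4 a}"
      using p(2) by (auto simp: up_def)
    then have "a \<in> snd ` up \<sigma> v a" "snd ` up \<sigma> v a \<subseteq> {a, next4 a}"
      by (auto simp: image_iff intro!: bexI)
    then have "snd ` up \<sigma> v a \<in> cross_polytope 1"
      unfolding cross_polytope_1_iff using p(3) by blast
    moreover have "u \<le> w" if "(u, b) \<in> up \<sigma> v a" "(w, next4 b) \<in> up \<sigma> v a" for u w b
      using that n4 next4_cycle(2)[OF n4(1)] by (auto simp: up_def)
    ultimately show "up \<sigma> v a \<in> circle_product K"
      using s(2) by (intro circle_productI) simp_all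
    have "card ({u \<in> \<sigma>. u \<le> v} \<union> {u \<in> \<sigma>. v \<le> u}) + card ({u \<in> \<sigma>. u \<le> v} \<inter> {u \<in> \<sigma>. v \<le> u})
        = card {u \<in> \<sigma>. u \<le> v} + card {u \<in> \<sigma>. v \<le> u}"
      using fin by (subst card_Un_Int) auto
    moreover have "{u \<in> \<sigma>. u \<le> v} \<union> {u \<in> \<sigma>. v \<le> u} = \<sigma>" "{u \<in> \<sigma>. u \<le> v} \<inter> {u \<in> \<sigma>. v \<le> u} = {v}"
      using p(2) by auto
    moreover have "card (up \<sigma> v a) = card {u \<in> \<sigma>. u \<le> v} + card {u \<in> \<sigma>. v \<le> u}"
      unfolding up_def using fin n4 by (subst card_Un_disjoint) (auto simp: card_cartesian_product)
    ultimately show "card (up \<sigma> v a) = Suc d + 1"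
      using s(3) by simp
  qed
  have ex1: "\<exists>L U. (L, U) \<in> J \<and> L \<subseteq> \<tau> \<and> \<tau> \<subseteq> U \<and>
      (\<forall>L' U'. (L', U') \<in> J \<longrightarrow> L' \<subseteq> \<tau> \<longrightarrow> \<tau> \<subseteq> U' \<longrightarrow> L' = L \<and> U' = U)"
    if t: "\<tau> \<in> circle_product K" for \<tau>
  proof -
    have tK: "fst ` \<tau> \<in> K" "snd ` \<tau> \<in> cross_polytope 1"
      and mono: "\<And>u v a. (u, a) \<in> \<tau> \<Longrightarrow> (v, next4 a) \<in> \<tau> \<Longrightarrow> u \<le> v"
      using t unfolding circle_product_def by blast+
    have fin: "finite \<tau>" using finite_complexD(2)[OF finite_complex_circle_product[OF K] t] .
    obtain a where a: "a < 4" "a \<in> snd ` \<tau>" "snd ` \<tau> \<subseteq> {a, next4 a}"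
      using tK(2) unfolding cross_polytope_1_iff by blast
    note n4 = next4_cycle[OF a(1)]
    define v where "v = Max {u. (u, a) \<in> \<tau>}"
    have finU: "finite {u. (u, a) \<in> \<tau>}"
      by (rule finite_subset[OF _ finite_imageI[OF fin, of fst]]) force
    have neU: "{u. (u, a) \<in> \<tau>} \<noteq> {}" using a(2) by force
    have v: "(v, a) \<in> \<tau>" "\<And>u. (u, a) \<in> \<tau> \<Longrightarrow> u \<le> v"
      using Max_in[OF finU neU] Max_ge[OF finU] by (auto simp: v_def)
    obtain R \<sigma> where p: "(R, \<sigma>) \<in> I" "R \<subseteq> fst ` \<tau>" "fst ` \<tau> \<subseteq> \<sigma>"
      using face_tiling_ex[OF I tK(1)] .
    have level: "b = a \<or> b = next4 a" if "(u, b) \<in> \<tau>" for u b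
      using that a(3) by force
    have lo: "lo R v a \<subseteq> \<tau>"
    proof
      fix w assume "w \<in> lo R v a"
      then consider "w = (v, a)" | r where "r \<in> R" "r < v" "w = (r, a)"
        | r where "r \<in> R" "v < r" "w = (r, next4 a)"
        by (auto simp: lo_def)
      then show "w \<in> \<tau>"
      proof cases
        case 1 then show ?thesis using v(1) by simp
      next
        case 2
        then obtain b where b: "(r, b) \<in> \<tau>" using p(2) by force
        then show ?thesis using level[OF b] mono[OF v(1), of r] 2 by auto
      next
        case 3
        then obtain b where b: "(r, b) \<in> \<tau>" using p(2) by force
        then show ?thesis using level[OF b] v(2)[of r] 3 by auto
      qed
    qed
    have up: "\<tau> \<subseteq> up \<sigma> v a"
    proof
      fix w assume w: "w \<in> \<tau>"
      then have "fst w \<in> \<sigma>" using p(3) by blast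
      then show "w \<in> up \<sigma> v a"
        using w level[of "fst w" "snd w"] v(2)[of "fst w"] mono[OF v(1), of "fst w"]
        by (cases w) (auto simp: up_def)
    qed
    have vs: "v \<in> \<sigma>" using v(1) p(3) by force
    have uniq: "L = lo R v a \<and> U = up \<sigma> v a" if q: "(L, U) \<in> J" "L \<subseteq> \<tau>" "\<tau> \<subseteq> U" for L U
    proof -
      obtain R' \<sigma>' v' a' where q': "L = lo R' v' a'" "U = up \<sigma>' v' a'" "(R', \<sigma>') \<in> I" "v' \<in> \<sigma>'" "a' < 4"
        using q(1) by (auto simp: J_def)
      have l: "lo R' v' a' \<subseteq> \<tau>" and u: "\<tau> \<subseteq> up \<sigma>' v' a'" using q q' by auto
      have v'a': "(v', a') \<in> \<tau>" using l by (auto simp: lo_def)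
      \<comment> \<open>each of \<open>a\<close> and \<open>a'\<close> equals the other one or follows it; both cannot follow each other on a 4-cycle\<close>
      have "a \<in> {a', next4 a'}" using v(1) u by (auto simp: up_def)
      moreover have "a' \<in> {a, next4 a}" using level[OF v'a'] by simp
      ultimately have aa: "a' = a" using next4_cycle(3)[OF q'(5)] by auto
      have "v \<le> v'" using v(1) u n4 aa by (auto simp: up_def)
      moreover have "v' \<le> v" using v(2) v'a' aa by simp
      ultimately have vv: "v' = v" by simp
      have "R' \<subseteq> fst ` \<tau>"
      proof
        fix r assume "r \<in> R'"
        then have "(r, a') \<in> lo R' v' a' \<or> (r, next4 a') \<in> lo R' v' a'"
          by (cases r v' rule: linorder_cases) (auto simp: lo_def)
        then show "r \<in> fst ` \<tau>" using l by force
      qed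
      moreover have "fst ` \<tau> \<subseteq> \<sigma>'" using u by (auto simp: up_def)
      ultimately have "R' = R" "\<sigma>' = \<sigma>"
        using face_tiling_unique[OF I tK(1) q'(3) _ _ p] by simp_all
      then show ?thesis using q' aa vv by simp
    qed
    have "(lo R v a, up \<sigma> v a) \<in> J" using p(1) vs a(1) by (auto simp: J_def)
    then show ?thesis using lo up uniq by blast
  qed
  have "face_tiling (circle_product K) (Suc d) J"
  proof (rule face_tilingI[OF _ ex1])
    fix L U assume "(L, U) \<in> J"
    then obtain R \<sigma> v a where "L = lo R v a" "U = up \<sigma> v a" "(R, \<sigma>) \<in> I" "v \<in> \<sigma>" "a < 4"
      by (auto simp: J_def)
    then show "L \<subseteq> U \<and> U \<in> circle_product K \<and> card U = Suc d + 1"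
      using props[of R \<sigma> v a] by simp
  qed
  then show ?thesis ..
qed

section \<open>Relabelling vertices\<close>

lemma face_tiling_relabel:
  assumes h: "inj h" and I: "face_tiling K d I"
  shows "face_tiling ((`) h ` K) d (map_prod ((`) h) ((`) h) ` I)"
proof -
  have sub: "h ` A \<subseteq> h ` B \<longleftrightarrow> A \<subseteq> B" for A B
    using h by (rule inj_image_subset_iff)
  define J where "J = map_prod ((`) h) ((`) h) ` I"
  have "face_tiling ((`) h ` K) d J"
  proof (rule face_tilingI)
    fix R \<sigma> assume "(R, \<sigma>) \<in> J"
    then obtain R0 \<sigma>0 where p: "(R0, \<sigma>0) \<in> I" "R = h ` R0" "\<sigma> = h ` \<sigma>0" by (auto simp: J_def)
    have "card (h ` \<sigma>0) = card \<sigma>0"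
      by (rule card_image[OF inj_on_subset[OF h subset_UNIV]])
    then show "R \<subseteq> \<sigma> \<and> \<sigma> \<in> (`) h ` K \<and> card \<sigma> = d + 1"
      using face_tilingD[OF I p(1)] p by auto
  next
    fix \<tau>' assume "\<tau>' \<in> (`) h ` K"
    then obtain \<tau> where t: "\<tau> \<in> K" "\<tau>' = h ` \<tau>" by blast
    obtain R \<sigma> where p: "(R, \<sigma>) \<in> I" "R \<subseteq> \<tau>" "\<tau> \<subseteq> \<sigma>"
      using face_tiling_ex[OF I t(1)] .
    have "R' = h ` R \<and> \<sigma>' = h ` \<sigma>"
      if q: "(R', \<sigma>') \<in> J" "R' \<subseteq> \<tau>'" "\<tau>' \<subseteq> \<sigma>'" for R' \<sigma>'
    proof -
      obtain R0 \<sigma>0 where q': "(R0, \<sigma>0) \<in> I" "R' = h ` R0" "\<sigma>' = h ` \<sigma>0" using q(1) by (auto simp: J_def)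
      have "R0 \<subseteq> \<tau>" "\<tau> \<subseteq> \<sigma>0" using q(2,3) unfolding q'(2,3) t(2) sub .
      then show ?thesis using face_tiling_unique[OF I t(1) p q'(1)] q' by simp
    qed
    moreover have "(h ` R, h ` \<sigma>) \<in> J" using p(1) by (force simp: J_def)
    moreover have "h ` R \<subseteq> \<tau>'" "\<tau>' \<subseteq> h ` \<sigma>" using p t by auto
    ultimately show "\<exists>R \<sigma>. (R, \<sigma>) \<in> J \<and> R \<subseteq> \<tau>' \<and> \<tau>' \<subseteq> \<sigma> \<and>
      (\<forall>R' \<sigma>'. (R', \<sigma>') \<in> J \<longrightarrow> R' \<subseteq> \<tau>' \<longrightarrow> \<tau>' \<subseteq> \<sigma>' \<longrightarrow> R' = R \<and> \<sigma>' = \<sigma>)"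
      by blast
  qed
  then show ?thesis by (simp only: J_def)
qed

lemma finite_complex_relabel:
  assumes K: "finite_complex K"
  shows "finite_complex ((`) h ` K)"
proof -
  have "\<tau> \<in> (`) h ` K" if "\<sigma> \<in> K" "\<tau> \<subseteq> h ` \<sigma>" "\<tau> \<noteq> {}" for \<sigma> \<tau>
  proof -
    obtain \<rho> where "\<rho> \<subseteq> \<sigma>" "\<tau> = h ` \<rho>" using \<open>\<tau> \<subseteq> h ` \<sigma>\<close> by (auto simp: subset_image_iff)
    then show ?thesis using finite_complexD(4)[OF K \<open>\<sigma> \<in> K\<close>] \<open>\<tau> \<noteq> {}\<close> by blast
  qed
  then show ?thesis
    using finite_complexD(1-3)[OF K] unfolding finite_complex_def by auto
qed

lemma continuous_on_comp_right:
  fixes S :: "('a \<Rightarrow> real) set" and g :: "'b \<Rightarrow> 'a"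
  shows "continuous_on S (\<lambda>x. x \<circ> g)"
  unfolding comp_def
  by (rule continuous_on_coordinatewise_then_product)
     (rule continuous_on_subset[OF continuous_on_product_coordinates subset_UNIV])

lemma realization_relabel:
  fixes h :: "'v \<Rightarrow> 'w"
  assumes K: "finite_complex K" and h: "bij h"
  shows "realization ((`) h ` K) homeomorphic_space realization K"
proof -
  have V: "finite (\<Union>K)" using finite_complex_vertices[OF K] .
  have hV: "finite (h ` \<Union>K)" "\<Union>((`) h ` K) \<subseteq> h ` \<Union>K" using V by auto
  note iffK = polyhedron_iff[OF K V order_refl]
  note iffhK = polyhedron_iff[OF finite_complex_relabel[OF K] hV]
  have surj: "h (inv h w) = w" for w using h by (simp add: bij_is_surj surj_f_inv_f)
  have inj: "inv h (h v) = v" for v using h by (simp add: bij_is_inj)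
  have supp_h: "supp x = h ` supp (x \<circ> h)" for x :: "'w \<Rightarrow> real"
  proof -
    have "w \<in> h ` supp (x \<circ> h)" if "x w \<noteq> 0" for w
      using that surj[of w] by (intro image_eqI[of _ _ "inv h w"]) (simp_all add: in_supp)
    then show ?thesis by (auto simp: in_supp)
  qed
  have mem: "x \<in> polyhedron_of ((`) h ` K) \<longleftrightarrow> x \<circ> h \<in> polyhedron_of K" for x
  proof -
    have "(\<forall>w. 0 \<le> x w) \<longleftrightarrow> (\<forall>v. 0 \<le> (x \<circ> h) v)" using surj by (metis comp_apply)
    moreover have "supp x \<in> (`) h ` K \<longleftrightarrow> supp (x \<circ> h) \<in> K"
      unfolding supp_h[of x] using inj_image_eq_iff[OF bij_is_inj[OF h]] by (simp add: image_iff)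
    moreover have "sum x (h ` \<Union>K) = sum (x \<circ> h) (\<Union>K)"
      using bij_is_inj[OF h] by (intro sum.reindex) (auto intro: inj_on_subset)
    ultimately show ?thesis unfolding iffK iffhK by (simp only:)
  qed
  have hh: "x \<circ> inv h \<circ> h = x" "y \<circ> h \<circ> inv h = y" for x :: "'v \<Rightarrow> real" and y :: "'w \<Rightarrow> real"
    by (simp_all add: fun_eq_iff inj surj)
  have "homeomorphic_maps (realization ((`) h ` K)) (realization K) (\<lambda>x. x \<circ> h) (\<lambda>x. x \<circ> inv h)"
    unfolding homeomorphic_maps_def realization_eq continuous_map_subtopology_eu
    using mem hh by (auto intro: continuous_on_comp_right)
  then show ?thesis by (auto simp: homeomorphic_space_def)
qed

section \<open>Iterating over the circle factors\<close>

lemma homeomorphic_space_product_topology_Suc: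
  "prod_topology (prod_topology X (product_topology (\<lambda>_. Y) {..<m})) Y homeomorphic_space
    prod_topology X (product_topology (\<lambda>_. Y) {..<Suc m})"
proof -
  let ?f = "\<lambda>((x, t), y). (x, \<lambda>i\<in>{..<Suc m}. if i = m then y else t i)"
  let ?g = "\<lambda>(x, s). ((x, restrict s {..<m}), s m)"
  let ?A = "prod_topology (prod_topology X (product_topology (\<lambda>_. Y) {..<m})) Y"
  let ?B = "prod_topology X (product_topology (\<lambda>_. Y) {..<Suc m})"
  have ti: "continuous_map ?A Y (\<lambda>p. snd (fst p) i)" if "i < m" for i
  proof -
    have "continuous_map ?A Y ((\<lambda>t. t i) \<circ> (snd \<circ> fst))"
      using that by (intro continuous_map_compose[of _ "product_topology (\<lambda>_. Y) {..<m}"]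
        continuous_map_compose[of _ "prod_topology X (product_topology (\<lambda>_. Y) {..<m})"]
        continuous_map_fst continuous_map_snd continuous_map_product_projection) auto
    then show ?thesis by (simp add: o_def)
  qed
  have si: "continuous_map ?B Y (\<lambda>p. snd p i)" if "i < Suc m" for i
  proof -
    have "continuous_map ?B Y ((\<lambda>t. t i) \<circ> snd)"
      using that by (intro continuous_map_compose[of _ "product_topology (\<lambda>_. Y) {..<Suc m}"]
        continuous_map_snd continuous_map_product_projection) auto
    then show ?thesis by (simp add: o_def)
  qed
  have x: "continuous_map ?A X (\<lambda>p. fst (fst p))"
    using continuous_map_compose[OF continuous_map_fst continuous_map_fst] by (simp add: o_def)
  have f: "continuous_map ?A ?B ?f"
    unfolding case_prod_unfold
  proof (intro continuous_map_pairedI x)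
    show "continuous_map ?A (product_topology (\<lambda>_. Y) {..<Suc m})
        (\<lambda>p. \<lambda>i\<in>{..<Suc m}. if i = m then snd p else snd (fst p) i)"
      unfolding continuous_map_componentwise
    proof (intro conjI ballI)
      show "continuous_map ?A Y (\<lambda>p. (\<lambda>i\<in>{..<Suc m}. if i = m then snd p else snd (fst p) i) k)"
        if "k \<in> {..<Suc m}" for k
        using that ti[of k] by (cases "k = m") (auto intro: continuous_map_snd)
    qed auto
  qed
  have g: "continuous_map ?B ?A ?g"
    unfolding case_prod_unfold
  proof (intro continuous_map_pairedI continuous_map_fst si)
    show "continuous_map ?B (product_topology (\<lambda>_. Y) {..<m}) (\<lambda>p. restrict (snd p) {..<m})"
      unfolding continuous_map_componentwise
    proof (intro conjI ballI)
      show "continuous_map ?B Y (\<lambda>p. restrict (snd p) {..<m} k)" if "k \<in> {..<m}" for k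
        using that si[of k] by simp
    qed auto
  qed simp
  have "homeomorphic_maps ?A ?B ?f ?g"
    unfolding homeomorphic_maps_def
  proof (intro conjI f g ballI)
    show "?g (?f p) = p" if "p \<in> topspace ?A" for p
    proof -
      obtain x t y where p: "p = ((x, t), y)" by (cases p) auto
      have "undefined = t i" if "\<not> i < m" for i
        using \<open>p \<in> topspace ?A\<close> that by (auto simp: p PiE_iff extensional_def)
      then show ?thesis by (auto simp: p fun_eq_iff)
    qed
    show "?f (?g p) = p" if "p \<in> topspace ?B" for p
    proof -
      obtain x s where p: "p = (x, s)" by (cases p)
      have "undefined = s i" if "\<not> i < Suc m" for i
        using \<open>p \<in> topspace ?B\<close> that by (auto simp: p PiE_iff extensional_def)
      then show ?thesis by (auto simp: p fun_eq_iff)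
    qed
  qed
  then show ?thesis by (auto simp: homeomorphic_space_def)
qed

text \<open>The complex, its dimension and its face tiling are carried through the induction together, since
  an h-tiling given as a set of subsets of the polyhedron would not be accessible to the product
  construction. The pairs of vertices are encoded as natural numbers after each step.\<close>
lemma sphere_times_torus_face_tiling:
  fixes n m :: nat
  shows "\<exists>(K :: nat set set) d I. finite_complex K \<and> face_tiling K d I \<and>
     realization K homeomorphic_space
       prod_topology (nsphere n) (product_topology (\<lambda>_. nsphere 1) {..<m})"
proof (induction m)
  case 0
  have "prod_topology (nsphere n) (product_topology (\<lambda>_. nsphere 1) {..<0::nat})
      homeomorphic_space nsphere n"
    by (intro prod_topology_homeomorphic_space_left[where b = "\<lambda>_. undefined"])
       (simp add: product_topology_empty_discrete)
  then have "realization (cross_polytope n) homeomorphic_space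
      prod_topology (nsphere n) (product_topology (\<lambda>_. nsphere 1) {..<0::nat})"
    by (rule homeomorphic_space_trans[OF realization_cross_polytope homeomorphic_space_sym[THEN iffD1]])
  moreover obtain I where "face_tiling (cross_polytope n) n I"
    using face_tiling_cross_polytope by blast
  ultimately show ?case
    using finite_complex_cross_polytope[of n]
    by (intro exI[of _ "cross_polytope n"] exI[of _ n] exI[of _ I] conjI)
next
  case (Suc m)
  let ?T = "\<lambda>m. prod_topology (nsphere n) (product_topology (\<lambda>_. nsphere 1) {..<m::nat})"
  obtain K :: "nat set set" and d I where K: "finite_complex K" "face_tiling K d I"
    "realization K homeomorphic_space ?T m"
    using Suc.IH by blast
  let ?P = "circle_product K"
  let ?K' = "(`) prod_encode ` ?P"
  have P: "finite_complex ?P" using finite_complex_circle_product[OF K(1)] .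
  obtain J where J: "face_tiling ?P (Suc d) J"
    using face_tiling_circle_product[OF K(1,2)] by blast
  have "realization ?K' homeomorphic_space realization ?P"
    using realization_relabel[OF P bij_prod_encode] .
  also have "realization ?P homeomorphic_space
      prod_topology (realization K) (realization (cross_polytope 1))"
    using realization_circle_product[OF K(1)] .
  also have "prod_topology (realization K) (realization (cross_polytope 1))
      homeomorphic_space prod_topology (?T m) (nsphere 1)"
    using K(3) realization_cross_polytope by (rule homeomorphic_space_prod_topology)
  also have "prod_topology (?T m) (nsphere 1) homeomorphic_space ?T (Suc m)"
    by (rule homeomorphic_space_product_topology_Suc)
  finally have "realization ?K' homeomorphic_space ?T (Suc m)" .
  moreover have "finite_complex ?K'" using finite_complex_relabel[OF P] .
  moreover have "face_tiling ?K' (Suc d) (map_prod ((`) prod_encode) ((`) prod_encode) ` J)"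
    using face_tiling_relabel[OF bij_is_inj[OF bij_prod_encode] J] .
  ultimately show ?case
    by (intro exI[of _ ?K'] exI[of _ "Suc d"] exI conjI)
qed

theorem theorem1p1:
  fixes n m :: nat
  assumes "m \<ge> 1"
  shows "\<exists>K :: nat set set. finite_complex K \<and>
           realization K homeomorphic_space
             prod_topology (nsphere n) (product_topology (\<lambda>_. nsphere 1) {..<m}) \<and>
           h_tileable K"
  using sphere_times_torus_face_tiling[of n m] h_tileable_if_face_tiling by blast

end
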